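(* The functor $S^D:\mathrm{Diff}\to\mathrm{sSet}$ sends smoothly homotopic maps to simplicially homotopic maps: if smooth maps $f,g:X\to Y$ of diffeological spaces are smoothly homotopic, then $S^D(f)$ and $S^D(g)$ are simplicially homotopic.
   Context: A diffeological space is a set $X$ together with, for each $n\in\mathbb{N}$ and each open $U\subseteq\mathbb{R}^n$, a specified set of functions $U\to X$ called plots, such that: every constant map is a plot; if $U\to X$ is a plot and $V\to U$ is a smooth map between open subsets of Euclidean spaces then the composite $V\to X$ is a plot; and a function $U\to X$ whose restriction to each member of some open cover of $U$ is a plot is itself a plot. A map $f:X\to Y$ is smooth if $f\circ p$ is a plot of $Y$ for every plot $p$ of $X$; $C^\infty(X,Y)$ is the set of smooth maps. $\mathrm{Diff}$ is the category of diffeological spaces and smooth maps; $\mathrm{sSet}$ is the category of simplicial sets. $\mathbb{R}^n$ has as plots the usual smooth maps; products have plots with both components plots. A subset $A\subseteq X$ has the sub-diffeology: $U\to A$ is a plot iff $U\to A\hookrightarrow X$ is. Smooth maps $f,g:X\to Y$ are smoothly homotopic if there is a smooth map $F:X\times\mathbb{R}\to Y$ with $F(x,0)=f(x)$ and $F(x,1)=g(x)$ for all $x\in X$. Maps $u,v:K\to L$ of simplicial sets are simplicially homotopic if there is a map $K\times\Delta^1\to L$ restricting to $u$ and $v$ at the two vertices of $\Delta^1$. Let $\mathbb{A}^n=\{(x_0,\dots,x_n)\in\mathbb{R}^{n+1}\mid\sum x_i=1\}$ with the sub-diffeology from $\mathbb{R}^{n+1}$. A map $f:\{0,\dots,n\}\to\{0,\dots,m\}$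 in the simplicial category induces $f_*:\mathbb{A}^n\to\mathbb{A}^m$, $f_*(x)_j=\sum_{i\in f^{-1}(j)}x_i$. $S^D(X)$ is the simplicial set with $S^D_n(X)=C^\infty(\mathbb{A}^n,X)$ and structure maps given by precomposition. *)

theory Defs
  imports "HOL-Analysis.Analysis"
begin

section \<open>Smooth maps between open subsets of Euclidean spaces\<close>

text \<open>
  Since the dimension varies inside the definition of a diffeology, the space of real
  \<open>n\<close>-tuples is the library's topological space \<^term>\<open>Euclidean_space n\<close>, whose points are
  the functions \<^typ>\<open>nat \<Rightarrow> real\<close> vanishing at all indices \<open>\<ge> n\<close>.

  \<open>Ck_on n k U f\<close>: all iterated partial derivatives of order \<open>\<le> k\<close> of the real function \<open>f\<close>
  exist and are continuous on the open set \<open>U\<close>. The values of \<open>f\<close> outside \<open>U\<close> play no role: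
  as \<open>U\<close> is open and \<open>i < n\<close>, the point \<open>x(i := t)\<close> lies in \<open>U\<close> for all \<open>t\<close> near \<open>x i\<close>.
\<close>

fun Ck_on :: "nat \<Rightarrow> nat \<Rightarrow> (nat \<Rightarrow> real) set \<Rightarrow> ((nat \<Rightarrow> real) \<Rightarrow> real) \<Rightarrow> bool" where
  "Ck_on n 0 U f \<longleftrightarrow> continuous_map (subtopology (Euclidean_space n) U) euclideanreal f"
| "Ck_on n (Suc k) U f \<longleftrightarrow>
     continuous_map (subtopology (Euclidean_space n) U) euclideanreal f \<and>
     (\<forall>i<n. \<exists>g. (\<forall>x\<in>U. ((\<lambda>t. f (x(i := t))) has_real_derivative g x) (at (x i))) \<and>
               Ck_on n k U g)"

definition smooth_fun_on :: "nat \<Rightarrow> (nat \<Rightarrow> real) set \<Rightarrow> ((nat \<Rightarrow> real) \<Rightarrow> real) \<Rightarrow> bool" where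
  "smooth_fun_on n U f \<longleftrightarrow> (\<forall>k. Ck_on n k U f)"

definition smooth_between ::
  "nat \<Rightarrow> (nat \<Rightarrow> real) set \<Rightarrow> nat \<Rightarrow> (nat \<Rightarrow> real) set \<Rightarrow> ((nat \<Rightarrow> real) \<Rightarrow> nat \<Rightarrow> real) \<Rightarrow> bool" where
  "smooth_between m V n U h \<longleftrightarrow> h \<in> V \<rightarrow> U \<and> (\<forall>i<n. smooth_fun_on m V (\<lambda>x. h x i))"

section \<open>Diffeological spaces\<close>

text \<open>
  \<open>plots X n U\<close> is only meaningful for \<open>U\<close> open in \<^term>\<open>Euclidean_space n\<close>.
  Functions \<open>U \<rightarrow> X\<close> are taken to be extensional, i.e. elements of \<^term>\<open>U \<rightarrow>\<^sub>E points X\<close>, so that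
  equality of maps is equality of HOL functions; composites are formed with \<^const>\<open>compose\<close>.
\<close>

record 'a diffeology =
  points :: "'a set"
  plots :: "nat \<Rightarrow> (nat \<Rightarrow> real) set \<Rightarrow> ((nat \<Rightarrow> real) \<Rightarrow> 'a) set"

locale diffeological_space =
  fixes X :: "'a diffeology"
  assumes plots_maps:
      "openin (Euclidean_space n) U \<Longrightarrow> plots X n U \<subseteq> U \<rightarrow>\<^sub>E points X"
    and plots_const:
      "\<lbrakk>openin (Euclidean_space n) U; c \<in> points X\<rbrakk> \<Longrightarrow> (\<lambda>u\<in>U. c) \<in> plots X n U"
    and plots_compose:
      "\<lbrakk>openin (Euclidean_space n) U; openin (Euclidean_space m) V;
        p \<in> plots X n U; smooth_between m V n U h\<rbrakk> \<Longrightarrow> compose V p h \<in> plots X m V"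
    and plots_local:
      "\<lbrakk>openin (Euclidean_space n) U; p \<in> U \<rightarrow>\<^sub>E points X;
        \<And>V. V \<in> \<V> \<Longrightarrow> openin (Euclidean_space n) V; \<Union>\<V> = U;
        \<And>V. V \<in> \<V> \<Longrightarrow> restrict p V \<in> plots X n V\<rbrakk> \<Longrightarrow> p \<in> plots X n U"

definition smooth_maps :: "'a diffeology \<Rightarrow> 'b diffeology \<Rightarrow> ('a \<Rightarrow> 'b) set" where
  "smooth_maps X Y = {f \<in> points X \<rightarrow>\<^sub>E points Y.
     \<forall>n U p. openin (Euclidean_space n) U \<longrightarrow> p \<in> plots X n U \<longrightarrow> compose U f p \<in> plots Y n U}"

definition euclidean_diffeology :: "nat \<Rightarrow> (nat \<Rightarrow> real) diffeology" where
  "euclidean_diffeology n =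
     \<lparr>points = topspace (Euclidean_space n),
      plots = (\<lambda>m U. {p \<in> U \<rightarrow>\<^sub>E topspace (Euclidean_space n).
                        smooth_between m U n (topspace (Euclidean_space n)) p})\<rparr>"

text \<open>The real line, with points of type \<^typ>\<open>real\<close> instead of 1-tuples.\<close>

definition real_diffeology :: "real diffeology" where
  "real_diffeology =
     \<lparr>points = UNIV, plots = (\<lambda>m U. {p \<in> U \<rightarrow>\<^sub>E UNIV. smooth_fun_on m U p})\<rparr>"

definition sub_diffeology :: "'a diffeology \<Rightarrow> 'a set \<Rightarrow> 'a diffeology" where
  "sub_diffeology X A =
     \<lparr>points = A, plots = (\<lambda>n U. {p \<in> U \<rightarrow>\<^sub>E A. p \<in> plots X n U})\<rparr>"

definition prod_diffeology :: "'a diffeology \<Rightarrow> 'b diffeology \<Rightarrow> ('a \<times> 'b) diffeology" where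
  "prod_diffeology X Y =
     \<lparr>points = points X \<times> points Y,
      plots = (\<lambda>n U. {p \<in> U \<rightarrow>\<^sub>E points X \<times> points Y.
                        compose U fst p \<in> plots X n U \<and> compose U snd p \<in> plots Y n U})\<rparr>"

definition smoothly_homotopic ::
  "'a diffeology \<Rightarrow> 'b diffeology \<Rightarrow> ('a \<Rightarrow> 'b) \<Rightarrow> ('a \<Rightarrow> 'b) \<Rightarrow> bool" where
  "smoothly_homotopic X Y f g \<longleftrightarrow>
     f \<in> smooth_maps X Y \<and> g \<in> smooth_maps X Y \<and>
     (\<exists>F \<in> smooth_maps (prod_diffeology X real_diffeology) Y.
        \<forall>x\<in>points X. F (x, 0) = f x \<and> F (x, 1) = g x)"

section \<open>Simplicial sets\<close>

text \<open>Morphisms \<open>[m] \<rightarrow> [n]\<close> of the simplicial category, where \<open>[n] = {0,\<dots>,n}\<close>.\<close>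

definition simplex_mor :: "nat \<Rightarrow> nat \<Rightarrow> (nat \<Rightarrow> nat) set" where
  "simplex_mor m n = {\<theta> \<in> {..m} \<rightarrow>\<^sub>E {..n}. mono_on {..m} \<theta>}"

text \<open>\<open>action K m n \<theta>\<close> is the structure map \<open>K\<^sub>n \<rightarrow> K\<^sub>m\<close> of \<open>\<theta> : [m] \<rightarrow> [n]\<close>.\<close>

record 'a sset =
  simplices :: "nat \<Rightarrow> 'a set"
  action :: "nat \<Rightarrow> nat \<Rightarrow> (nat \<Rightarrow> nat) \<Rightarrow> 'a \<Rightarrow> 'a"

locale simplicial_set =
  fixes K :: "'a sset"
  assumes action_maps:
      "\<theta> \<in> simplex_mor m n \<Longrightarrow> action K m n \<theta> \<in> simplices K n \<rightarrow> simplices K m"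
    and action_id:
      "x \<in> simplices K n \<Longrightarrow> action K n n (\<lambda>i\<in>{..n}. i) x = x"
    and action_compose:
      "\<lbrakk>\<theta> \<in> simplex_mor l m; \<phi> \<in> simplex_mor m n; x \<in> simplices K n\<rbrakk> \<Longrightarrow>
        action K l n (compose {..l} \<phi> \<theta>) x = action K l m \<theta> (action K m n \<phi> x)"

definition simplicial_map :: "'a sset \<Rightarrow> 'b sset \<Rightarrow> (nat \<Rightarrow> 'a \<Rightarrow> 'b) \<Rightarrow> bool" where
  "simplicial_map K L u \<longleftrightarrow>
     (\<forall>n. u n \<in> simplices K n \<rightarrow>\<^sub>E simplices L n) \<and>
     (\<forall>m n \<theta> x. \<theta> \<in> simplex_mor m n \<longrightarrow> x \<in> simplices K n \<longrightarrow>
        u m (action K m n \<theta> x) = action L m n \<theta> (u n x))"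

definition sset_prod :: "'a sset \<Rightarrow> 'b sset \<Rightarrow> ('a \<times> 'b) sset" where
  "sset_prod K L =
     \<lparr>simplices = (\<lambda>n. simplices K n \<times> simplices L n),
      action = (\<lambda>m n \<theta>. map_prod (action K m n \<theta>) (action L m n \<theta>))\<rparr>"

definition standard_simplex :: "nat \<Rightarrow> (nat \<Rightarrow> nat) sset" where
  "standard_simplex k =
     \<lparr>simplices = (\<lambda>n. simplex_mor n k), action = (\<lambda>m n \<theta> \<sigma>. compose {..m} \<sigma> \<theta>)\<rparr>"

text \<open>
  The constant map \<open>[n] \<rightarrow> [1]\<close> at \<open>e \<in> {0, 1}\<close> is the totally degenerate \<open>n\<close>-simplex at the
  vertex \<open>e\<close> of \<open>\<Delta>\<^sup>1\<close>; restricting to that vertex means inserting it as second component.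
  The predicate includes that \<open>u\<close> and \<open>v\<close> are maps of simplicial sets from \<open>K\<close> to \<open>L\<close>.
\<close>

definition simplicially_homotopic ::
  "'a sset \<Rightarrow> 'b sset \<Rightarrow> (nat \<Rightarrow> 'a \<Rightarrow> 'b) \<Rightarrow> (nat \<Rightarrow> 'a \<Rightarrow> 'b) \<Rightarrow> bool" where
  "simplicially_homotopic K L u v \<longleftrightarrow>
     simplicial_set K \<and> simplicial_set L \<and> simplicial_map K L u \<and> simplicial_map K L v \<and>
     (\<exists>H. simplicial_map (sset_prod K (standard_simplex 1)) L H \<and>
          (\<forall>n. \<forall>x\<in>simplices K n.
             H n (x, \<lambda>i\<in>{..n}. 0) = u n x \<and> H n (x, \<lambda>i\<in>{..n}. 1) = v n x))"

section \<open>The smooth singular functor\<close>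

definition affine_simplex :: "nat \<Rightarrow> (nat \<Rightarrow> real) diffeology" where
  "affine_simplex n =
     sub_diffeology (euclidean_diffeology (Suc n))
       {x \<in> topspace (Euclidean_space (Suc n)). (\<Sum>i\<le>n. x i) = 1}"

definition affine_push :: "nat \<Rightarrow> nat \<Rightarrow> (nat \<Rightarrow> nat) \<Rightarrow> (nat \<Rightarrow> real) \<Rightarrow> nat \<Rightarrow> real" where
  "affine_push n m \<theta> x = (\<lambda>j. if j \<le> m then \<Sum>i | i \<le> n \<and> \<theta> i = j. x i else 0)"

definition SD :: "'a diffeology \<Rightarrow> ((nat \<Rightarrow> real) \<Rightarrow> 'a) sset" where
  "SD X =
     \<lparr>simplices = (\<lambda>n. smooth_maps (affine_simplex n) X),
      action = (\<lambda>m n \<theta> \<sigma>. compose (points (affine_simplex m)) \<sigma> (affine_push m n \<theta>))\<rparr>"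

definition SD_map ::
  "'a diffeology \<Rightarrow> ('a \<Rightarrow> 'b) \<Rightarrow> nat \<Rightarrow> ((nat \<Rightarrow> real) \<Rightarrow> 'a) \<Rightarrow> (nat \<Rightarrow> real) \<Rightarrow> 'b" where
  "SD_map X f n = (\<lambda>\<sigma>\<in>simplices (SD X) n. compose (points (affine_simplex n)) f \<sigma>)"

end

theory Submission
  imports Defs
begin

text \<open>
  A smooth homotopy \<open>F\<close> from \<open>f\<close> to \<open>g\<close> yields the simplicial homotopy
  \<open>H\<^sub>n(\<sigma>, \<phi>)(x) = F (\<sigma> x, \<phi>\<^sub>*(x)\<^sub>1)\<close>, for \<open>n\<close>-simplices \<open>\<sigma>\<close> of \<^term>\<open>SD X\<close> and \<open>\<phi> : [n] \<rightarrow> [1]\<close> of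
  \<open>\<Delta>\<^sup>1\<close>; the coordinate \<open>y \<mapsto> y\<^sub>1\<close> identifies the affine 1-simplex with the real line.
  It is smooth in \<open>x\<close> because \<open>\<phi>\<^sub>*(x)\<^sub>1\<close> is a finite sum of coordinates of \<open>x\<close>
  (\<open>affine_push_coordinate_smooth\<close>), and natural in \<open>[n]\<close> because \<open>\<theta> \<mapsto> \<theta>\<^sub>*\<close> is functorial
  (\<open>affine_push_compose\<close>). If \<open>\<phi>\<close> is constant at \<open>0\<close> the sum is empty, and if \<open>\<phi>\<close> is constant
  at \<open>1\<close> it is the sum of all barycentric coordinates, which is \<open>1\<close>; so \<open>H\<close> restricts to
  \<open>S\<^sup>D(f)\<close> and \<open>S\<^sup>D(g)\<close> at the two vertices.

  The analytic input is that smooth functions are closed under finite sums. As maps are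
  extensional, it is also needed that smoothness on an open set depends only on the values
  there (\<open>Ck_on_cong\<close>).
\<close>

section \<open>Finite sums of smooth functions\<close>

text \<open>
  Openness in \<^term>\<open>Euclidean_space n\<close> gives room in each of the first \<open>n\<close> coordinate directions,
  so partial derivatives at points of \<open>U\<close> only see values on \<open>U\<close>.
\<close>

lemma eventually_fun_upd_in_openin:
  assumes U: "openin (Euclidean_space n) U" and x: "x \<in> U" and i: "i < n"
  shows "\<forall>\<^sub>F t in nhds (x i). x(i := t) \<in> U"
proof -
  have x0: "x j = 0" if "j \<ge> n" for j
    using openin_subset[OF U] x that by (auto simp: topspace_Euclidean_space)
  have "continuous_map euclideanreal (Euclidean_space n) (\<lambda>t. x(i := t))"
    unfolding Euclidean_space_def continuous_map_in_subtopology continuous_map_componentwise_UNIV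
    using x0 i by (auto simp: fun_upd_def)
  from openin_continuous_map_preimage[OF this U]
  have "open {t. x(i := t) \<in> U}" by simp
  moreover have "x i \<in> {t. x(i := t) \<in> U}" using x by simp
  ultimately show ?thesis by (auto simp: eventually_nhds)
qed

lemma Ck_on_cong:
  assumes U: "openin (Euclidean_space n) U"
  shows "Ck_on n k U f \<Longrightarrow> (\<And>x. x \<in> U \<Longrightarrow> f x = g x) \<Longrightarrow> Ck_on n k U g"
proof (cases k)
  case 0
  assume "Ck_on n k U f" "\<And>x. x \<in> U \<Longrightarrow> f x = g x"
  with 0 show ?thesis by (auto intro: continuous_map_eq)
next
  case (Suc k')
  assume f: "Ck_on n k U f" and eq: "\<And>x. x \<in> U \<Longrightarrow> f x = g x"
  have "((\<lambda>t. g (x(i := t))) has_real_derivative d) (at (x i))"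
    if "((\<lambda>t. f (x(i := t))) has_real_derivative d) (at (x i))" "x \<in> U" "i < n" for x i d
  proof -
    have "\<forall>\<^sub>F t in nhds (x i). f (x(i := t)) = g (x(i := t))"
      using eventually_fun_upd_in_openin[OF U that(2,3)] by (rule eventually_mono) (rule eq)
    then show ?thesis using that(1) by (subst (asm) DERIV_cong_ev) auto
  qed
  moreover have "continuous_map (subtopology (Euclidean_space n) U) euclideanreal g"
    using f Suc eq by (auto intro: continuous_map_eq)
  ultimately show ?thesis using f Suc by fastforce
qed

lemma Ck_on_const: "Ck_on n k U (\<lambda>x. c)"
proof (induction k arbitrary: c)
  case (Suc k)
  then show ?case by (auto intro!: exI[of _ "\<lambda>x. 0"])
qed simp

lemma Ck_on_add:
  "Ck_on n k U f \<Longrightarrow> Ck_on n k U g \<Longrightarrow> Ck_on n k U (\<lambda>x. f x + g x)"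
proof (induction k arbitrary: f g)
  case 0
  then show ?case by (auto intro: continuous_map_add)
next
  case (Suc k)
  have "\<exists>h. (\<forall>x\<in>U. ((\<lambda>t. f (x(i := t)) + g (x(i := t))) has_real_derivative h x) (at (x i))) \<and>
            Ck_on n k U h" if i: "i < n" for i
  proof -
    obtain f' where f': "\<And>x. x \<in> U \<Longrightarrow> ((\<lambda>t. f (x(i := t))) has_real_derivative f' x) (at (x i))"
      "Ck_on n k U f'" using Suc.prems(1) i unfolding Ck_on.simps by meson
    obtain g' where g': "\<And>x. x \<in> U \<Longrightarrow> ((\<lambda>t. g (x(i := t))) has_real_derivative g' x) (at (x i))"
      "Ck_on n k U g'" using Suc.prems(2) i unfolding Ck_on.simps by meson
    show ?thesis
      by (rule exI[of _ "\<lambda>x. f' x + g' x"]) (auto intro!: DERIV_add f' g' Suc.IH)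
  qed
  then show ?case using Suc.prems by (auto intro: continuous_map_add)
qed

lemma smooth_fun_on_cong:
  assumes "openin (Euclidean_space n) U" "smooth_fun_on n U f" "\<And>x. x \<in> U \<Longrightarrow> f x = g x"
  shows "smooth_fun_on n U g"
  using assms Ck_on_cong unfolding smooth_fun_on_def by blast

lemma smooth_fun_on_sum:
  assumes "finite I" "\<And>i. i \<in> I \<Longrightarrow> smooth_fun_on n U (f i)"
  shows "smooth_fun_on n U (\<lambda>x. \<Sum>i\<in>I. f i x)"
  using assms
  by (induction I) (auto simp: smooth_fun_on_def Ck_on_const Ck_on_add)

section \<open>Smooth maps\<close>

lemma compose_compose:
  "p \<in> U \<rightarrow> A \<Longrightarrow> compose U (compose A f s) p = compose U f (compose U s p)"
  by (auto simp: compose_def fun_eq_iff)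

lemma smooth_maps_mapsD: "s \<in> smooth_maps X Y \<Longrightarrow> s \<in> points X \<rightarrow>\<^sub>E points Y"
  by (simp add: smooth_maps_def)

text \<open>
  Composites in this theory are extended by \<^const>\<open>undefined\<close> off \<^term>\<open>points A\<close>, so the plots
  of \<open>A\<close> must take values in \<^term>\<open>points A\<close>. This is all that is needed of a diffeology, and
  for affine simplices it holds by definition.
\<close>

lemma smooth_maps_compose:
  assumes A: "\<And>n U. openin (Euclidean_space n) U \<Longrightarrow> plots A n U \<subseteq> U \<rightarrow> points A"
    and s: "s \<in> smooth_maps A X" and f: "f \<in> smooth_maps X Y"
  shows "compose (points A) f s \<in> smooth_maps A Y"
proof -
  have "compose U (compose (points A) f s) p \<in> plots Y n U"
    if U: "openin (Euclidean_space n) U" and p: "p \<in> plots A n U" for n U p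
  proof -
    have "compose U f (compose U s p) \<in> plots Y n U"
      using s f U p unfolding smooth_maps_def by blast
    moreover have "p \<in> U \<rightarrow> points A" using A U p by blast
    ultimately show ?thesis by (simp add: compose_compose)
  qed
  moreover have "compose (points A) f s \<in> points A \<rightarrow>\<^sub>E points Y"
    using s f by (auto simp: smooth_maps_def compose_def)
  ultimately show ?thesis by (auto simp: smooth_maps_def)
qed

lemma smooth_maps_pair:
  assumes s: "s \<in> smooth_maps A X" and t: "t \<in> smooth_maps A Y"
    and A: "\<And>n U. openin (Euclidean_space n) U \<Longrightarrow> plots A n U \<subseteq> U \<rightarrow> points A"
  shows "(\<lambda>x\<in>points A. (s x, t x)) \<in> smooth_maps A (prod_diffeology X Y)"
proof -
  let ?h = "\<lambda>x\<in>points A. (s x, t x)"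
  have "compose U ?h p \<in> plots (prod_diffeology X Y) n U"
    if U: "openin (Euclidean_space n) U" and p: "p \<in> plots A n U" for n U p
  proof -
    have pU: "p \<in> U \<rightarrow> points A" using A U p by blast
    then have "compose U fst (compose U ?h p) = compose U s p"
      "compose U snd (compose U ?h p) = compose U t p"
      by (auto simp: compose_def fun_eq_iff)
    moreover have "compose U s p \<in> plots X n U" "compose U t p \<in> plots Y n U"
      using s t U p unfolding smooth_maps_def by blast+
    moreover have "compose U ?h p \<in> U \<rightarrow>\<^sub>E points X \<times> points Y"
      using pU smooth_maps_mapsD[OF s] smooth_maps_mapsD[OF t]
      by (auto simp: compose_def Pi_iff)
    ultimately show ?thesis by (simp add: prod_diffeology_def)
  qed
  moreover have "?h \<in> points A \<rightarrow>\<^sub>E points (prod_diffeology X Y)"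
    using smooth_maps_mapsD[OF s] smooth_maps_mapsD[OF t] by (auto simp: prod_diffeology_def)
  ultimately show ?thesis by (auto simp: smooth_maps_def)
qed

section \<open>Affine simplices\<close>

lemma points_affine_simplex:
  "points (affine_simplex n) = {x. (\<forall>i>n. x i = 0) \<and> (\<Sum>i\<le>n. x i) = 1}"
  by (auto simp: affine_simplex_def sub_diffeology_def topspace_Euclidean_space Suc_le_eq)

lemma plots_affine_simplex:
  "plots (affine_simplex n) m U =
     {p \<in> U \<rightarrow>\<^sub>E points (affine_simplex n). \<forall>i\<le>n. smooth_fun_on m U (\<lambda>u. p u i)}"
  by (auto simp: affine_simplex_def sub_diffeology_def euclidean_diffeology_def
      smooth_between_def less_Suc_eq_le PiE_iff)

lemma plots_affine_simplex_maps:
  "plots (affine_simplex n) m U \<subseteq> U \<rightarrow> points (affine_simplex n)"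
  by (auto simp: plots_affine_simplex)

lemma simplex_mor_maps: "\<theta> \<in> simplex_mor m n \<Longrightarrow> \<theta> \<in> {..m} \<rightarrow> {..n}"
  by (auto simp: simplex_mor_def)

lemma compose_simplex_mor:
  assumes "\<theta> \<in> simplex_mor l m" "\<phi> \<in> simplex_mor m n"
  shows "compose {..l} \<phi> \<theta> \<in> simplex_mor l n"
  using assms
  by (auto simp: simplex_mor_def compose_def PiE_iff intro!: mono_onI elim!: mono_onD)

lemma affine_push_id:
  assumes "\<forall>i>n. x i = 0"
  shows "affine_push n n (\<lambda>i\<in>{..n}. i) x = x"
proof
  fix j
  have "{i. i \<le> n \<and> (\<lambda>i\<in>{..n}. i) i = j} = (if j \<le> n then {j} else {})" by auto
  then show "affine_push n n (\<lambda>i\<in>{..n}. i) x j = x j"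
    using assms by (simp add: affine_push_def)
qed

text \<open>
  Functoriality \<open>(\<phi> \<circ> \<theta>)\<^sub>* = \<phi>\<^sub>* \<circ> \<theta>\<^sub>*\<close>. It gives both the simplicial identities of \<^term>\<open>SD X\<close>
  and the naturality of the homotopy.
\<close>

lemma affine_push_compose:
  assumes \<theta>: "\<theta> \<in> {..l} \<rightarrow> {..m}"
  shows "affine_push l n (compose {..l} \<phi> \<theta>) x = affine_push m n \<phi> (affine_push l m \<theta> x)"
proof
  fix j
  \<comment> \<open>Group the sum over the fibre of \<open>\<phi> \<circ> \<theta>\<close> at \<open>j\<close> by the values \<open>k\<close> of \<open>\<theta>\<close>.\<close>
  have "(\<Sum>i | i \<le> l \<and> compose {..l} \<phi> \<theta> i = j. x i) =
      (\<Sum>k | k \<le> m \<and> \<phi> k = j.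
         \<Sum>i | i \<in> {i. i \<le> l \<and> compose {..l} \<phi> \<theta> i = j} \<and> \<theta> i = k. x i)"
    by (rule sum.group[symmetric]) (use \<theta> in \<open>auto simp: compose_def\<close>)
  also have "\<dots> = (\<Sum>k | k \<le> m \<and> \<phi> k = j. affine_push l m \<theta> x k)"
    by (intro sum.cong refl) (auto simp: affine_push_def compose_def intro!: sum.cong)
  finally show "affine_push l n (compose {..l} \<phi> \<theta>) x j =
      affine_push m n \<phi> (affine_push l m \<theta> x) j"
    by (simp add: affine_push_def)
qed

lemma affine_push_in_points:
  assumes \<theta>: "\<theta> \<in> {..m} \<rightarrow> {..n}" and x: "x \<in> points (affine_simplex m)"
  shows "affine_push m n \<theta> x \<in> points (affine_simplex n)"
proof -
  have "(\<Sum>j\<le>n. affine_push m n \<theta> x j) = (\<Sum>j\<le>n. \<Sum>i | i \<in> {..m} \<and> \<theta> i = j. x i)"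
    by (intro sum.cong) (auto simp: affine_push_def)
  also have "\<dots> = (\<Sum>i\<le>m. x i)"
    by (rule sum.group) (use \<theta> in auto)
  finally show ?thesis using x by (simp add: points_affine_simplex affine_push_def)
qed

lemma smooth_fun_on_affine_push:
  assumes "p \<in> plots (affine_simplex n) k U"
  shows "smooth_fun_on k U (\<lambda>u. affine_push n m \<theta> (p u) j)"
proof -
  \<comment> \<open>The condition \<open>j \<le> m\<close> under the sum covers the coordinates beyond \<open>m\<close>, which are \<open>0\<close>.\<close>
  have "smooth_fun_on k U (\<lambda>u. \<Sum>i | i \<le> n \<and> \<theta> i = j \<and> j \<le> m. p u i)"
    by (rule smooth_fun_on_sum) (use assms in \<open>auto simp: plots_affine_simplex\<close>)
  then show ?thesis by (cases "j \<le> m") (simp_all add: affine_push_def)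
qed

lemma affine_push_smooth:
  assumes \<theta>: "\<theta> \<in> {..m} \<rightarrow> {..n}"
  shows "(\<lambda>x\<in>points (affine_simplex m). affine_push m n \<theta> x)
           \<in> smooth_maps (affine_simplex m) (affine_simplex n)" (is "?h \<in> _")
proof -
  have "compose U ?h p \<in> plots (affine_simplex n) k U"
    if U: "openin (Euclidean_space k) U" and p: "p \<in> plots (affine_simplex m) k U" for k U p
  proof -
    have pU: "p \<in> U \<rightarrow> points (affine_simplex m)" using p plots_affine_simplex_maps by blast
    have "smooth_fun_on k U (\<lambda>u. compose U ?h p u j)" for j
      by (rule smooth_fun_on_cong[OF U smooth_fun_on_affine_push[OF p, of n \<theta> j]])
        (use pU in \<open>auto simp: compose_def\<close>)
    moreover have "compose U ?h p \<in> U \<rightarrow>\<^sub>E points (affine_simplex n)"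
      using pU affine_push_in_points[OF \<theta>] by (auto simp: compose_def Pi_iff)
    ultimately show ?thesis by (simp add: plots_affine_simplex)
  qed
  then show ?thesis using affine_push_in_points[OF \<theta>] by (auto simp: smooth_maps_def)
qed

lemma affine_push_coordinate_smooth:
  "(\<lambda>x\<in>points (affine_simplex n). affine_push n m \<theta> x j)
     \<in> smooth_maps (affine_simplex n) real_diffeology" (is "?h \<in> _")
proof -
  have "compose U ?h p \<in> plots real_diffeology k U"
    if U: "openin (Euclidean_space k) U" and p: "p \<in> plots (affine_simplex n) k U" for k U p
  proof -
    have pU: "p \<in> U \<rightarrow> points (affine_simplex n)" using p plots_affine_simplex_maps by blast
    have "smooth_fun_on k U (compose U ?h p)"
      by (rule smooth_fun_on_cong[OF U smooth_fun_on_affine_push[OF p, of m \<theta> j]])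
        (use pU in \<open>auto simp: compose_def\<close>)
    then show ?thesis by (simp add: real_diffeology_def compose_def)
  qed
  then show ?thesis by (auto simp: smooth_maps_def real_diffeology_def)
qed

section \<open>The smooth singular simplicial set\<close>

lemma simplices_SD: "simplices (SD X) n = smooth_maps (affine_simplex n) X"
  by (simp add: SD_def)

lemma action_SD:
  "action (SD X) m n \<theta> \<sigma> = compose (points (affine_simplex m)) \<sigma> (affine_push m n \<theta>)"
  by (simp add: SD_def)

lemma action_SD_in_simplices:
  assumes \<theta>: "\<theta> \<in> simplex_mor m n" and \<sigma>: "\<sigma> \<in> simplices (SD X) n"
  shows "action (SD X) m n \<theta> \<sigma> \<in> simplices (SD X) m"
proof -
  let ?h = "\<lambda>x\<in>points (affine_simplex m). affine_push m n \<theta> x"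
  have "compose (points (affine_simplex m)) \<sigma> ?h \<in> smooth_maps (affine_simplex m) X"
    using \<sigma> affine_push_smooth[OF simplex_mor_maps[OF \<theta>]] plots_affine_simplex_maps
    by (intro smooth_maps_compose) (auto simp: simplices_SD)
  moreover have "compose (points (affine_simplex m)) \<sigma> ?h = action (SD X) m n \<theta> \<sigma>"
    by (auto simp: action_SD compose_def fun_eq_iff)
  ultimately show ?thesis by (simp add: simplices_SD)
qed

lemma simplicial_set_SD: "simplicial_set (SD X)"
proof
  show "action (SD X) m n \<theta> \<in> simplices (SD X) n \<rightarrow> simplices (SD X) m"
    if "\<theta> \<in> simplex_mor m n" for \<theta> m n
    using that action_SD_in_simplices by blast
  show "action (SD X) n n (\<lambda>i\<in>{..n}. i) \<sigma> = \<sigma>" if "\<sigma> \<in> simplices (SD X) n" for \<sigma> n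
  proof (rule extensionalityI[where A = "points (affine_simplex n)"])
    show "\<sigma> \<in> extensional (points (affine_simplex n))"
      using that by (auto simp: simplices_SD smooth_maps_def PiE_iff)
  qed (simp_all add: action_SD compose_def affine_push_id points_affine_simplex)
  show "action (SD X) l n (compose {..l} \<phi> \<theta>) \<sigma> = action (SD X) l m \<theta> (action (SD X) m n \<phi> \<sigma>)"
    if "\<theta> \<in> simplex_mor l m" "\<phi> \<in> simplex_mor m n" for \<theta> l m \<phi> n \<sigma>
    using simplex_mor_maps[OF that(1)]
    by (auto simp: action_SD compose_def[of "points _"] fun_eq_iff affine_push_in_points
        affine_push_compose)
qed

lemma simplicial_map_SD:
  assumes f: "f \<in> smooth_maps X Y"
  shows "simplicial_map (SD X) (SD Y) (SD_map X f)"
  unfolding simplicial_map_def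
proof (intro conjI allI impI)
  show "SD_map X f n \<in> simplices (SD X) n \<rightarrow>\<^sub>E simplices (SD Y) n" for n
    using smooth_maps_compose[OF plots_affine_simplex_maps _ f]
    by (auto simp: SD_map_def simplices_SD)
  show "SD_map X f m (action (SD X) m n \<theta> \<sigma>) = action (SD Y) m n \<theta> (SD_map X f n \<sigma>)"
    if "\<theta> \<in> simplex_mor m n" "\<sigma> \<in> simplices (SD X) n" for m n \<theta> \<sigma>
    using that action_SD_in_simplices[OF that] affine_push_in_points[OF simplex_mor_maps[OF that(1)]]
    by (auto simp: SD_map_def action_SD compose_def fun_eq_iff)
qed

section \<open>The simplicial homotopy\<close>

text \<open>
  The prism operator of \<open>F\<close>: the \<open>n\<close>-simplex \<open>x \<mapsto> F (\<sigma> x, \<phi>\<^sub>*(x)\<^sub>1)\<close> of \<open>S\<^sup>D(Y)\<close> for an \<open>n\<close>-simplex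
  \<open>\<sigma>\<close> of \<open>S\<^sup>D(X)\<close> and an \<open>n\<close>-simplex \<open>\<phi>\<close> of \<open>\<Delta>\<^sup>1\<close>, extended by \<^const>\<open>undefined\<close> off the set of
  such pairs.
\<close>

definition SD_prism ::
  "'a diffeology \<Rightarrow> ('a \<times> real \<Rightarrow> 'b) \<Rightarrow> nat \<Rightarrow> ((nat \<Rightarrow> real) \<Rightarrow> 'a) \<times> (nat \<Rightarrow> nat) \<Rightarrow>
     (nat \<Rightarrow> real) \<Rightarrow> 'b" where
  "SD_prism X F n =
     (\<lambda>(\<sigma>, \<phi>)\<in>simplices (SD X) n \<times> simplex_mor n 1.
        \<lambda>x\<in>points (affine_simplex n). F (\<sigma> x, affine_push n 1 \<phi> x 1))"

lemma SD_prism_in_simplices: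
  assumes F: "F \<in> smooth_maps (prod_diffeology X real_diffeology) Y"
    and \<sigma>: "\<sigma> \<in> simplices (SD X) n"
  shows "(\<lambda>x\<in>points (affine_simplex n). F (\<sigma> x, affine_push n m \<phi> x j)) \<in> simplices (SD Y) n"
proof -
  let ?A = "affine_simplex n"
  let ?t = "\<lambda>x\<in>points ?A. affine_push n m \<phi> x j"
  have "(\<lambda>x\<in>points ?A. (\<sigma> x, ?t x)) \<in> smooth_maps ?A (prod_diffeology X real_diffeology)"
    using \<sigma> unfolding simplices_SD
    by (rule smooth_maps_pair[OF _ affine_push_coordinate_smooth plots_affine_simplex_maps])
  from smooth_maps_compose[OF plots_affine_simplex_maps this F]
  have "compose (points ?A) F (\<lambda>x\<in>points ?A. (\<sigma> x, ?t x)) \<in> simplices (SD Y) n"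
    by (simp add: simplices_SD)
  moreover have "compose (points ?A) F (\<lambda>x\<in>points ?A. (\<sigma> x, ?t x)) =
      (\<lambda>x\<in>points ?A. F (\<sigma> x, affine_push n m \<phi> x j))"
    by (auto simp: compose_def fun_eq_iff)
  ultimately show ?thesis by simp
qed

lemma simplicial_map_SD_prism:
  assumes F: "F \<in> smooth_maps (prod_diffeology X real_diffeology) Y"
  shows "simplicial_map (sset_prod (SD X) (standard_simplex 1)) (SD Y) (SD_prism X F)"
  unfolding simplicial_map_def
proof (intro conjI allI impI)
  let ?K = "sset_prod (SD X) (standard_simplex 1)"
  show "SD_prism X F n \<in> simplices ?K n \<rightarrow>\<^sub>E simplices (SD Y) n" for n
    using SD_prism_in_simplices[OF F]
    by (auto simp: SD_prism_def sset_prod_def standard_simplex_def)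
  show "SD_prism X F m (action ?K m n \<theta> z) = action (SD Y) m n \<theta> (SD_prism X F n z)"
    if \<theta>: "\<theta> \<in> simplex_mor m n" and z: "z \<in> simplices ?K n" for m n \<theta> z
  proof -
    obtain \<sigma> \<phi> where [simp]: "z = (\<sigma>, \<phi>)" and \<sigma>: "\<sigma> \<in> simplices (SD X) n"
      and \<phi>: "\<phi> \<in> simplex_mor n 1"
      using z by (auto simp: sset_prod_def standard_simplex_def)
    have act: "action ?K m n \<theta> z = (action (SD X) m n \<theta> \<sigma>, compose {..m} \<phi> \<theta>)"
      by (simp add: sset_prod_def standard_simplex_def)
    show ?thesis
      using \<sigma> \<phi> action_SD_in_simplices[OF \<theta> \<sigma>] compose_simplex_mor[OF \<theta> \<phi>]
        affine_push_in_points[OF simplex_mor_maps[OF \<theta>]]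
        affine_push_compose[OF simplex_mor_maps[OF \<theta>]]
      unfolding act
      by (auto simp: SD_prism_def action_SD compose_def[of "points _"] fun_eq_iff)
  qed
qed

lemma affine_push_const_0: "affine_push n 1 (\<lambda>i\<in>{..n}. 0) x 1 = 0"
  by (auto simp: affine_push_def intro!: sum.neutral)

lemma affine_push_const_1:
  assumes "x \<in> points (affine_simplex n)"
  shows "affine_push n 1 (\<lambda>i\<in>{..n}. 1) x 1 = 1"
proof -
  have "{i. i \<le> n \<and> (\<lambda>i\<in>{..n}. 1::nat) i = 1} = {..n}" by auto
  then show ?thesis using assms by (simp add: affine_push_def points_affine_simplex)
qed

lemma const_simplex_mor: "e \<le> k \<Longrightarrow> (\<lambda>i\<in>{..n}. e) \<in> simplex_mor n k"
  by (auto simp: simplex_mor_def mono_on_def)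

theorem lemma4p10:
  fixes X :: "'a diffeology" and Y :: "'b diffeology" and f g :: "'a \<Rightarrow> 'b"
  assumes "diffeological_space X" and "diffeological_space Y"
    and "f \<in> smooth_maps X Y" and "g \<in> smooth_maps X Y"
    and "smoothly_homotopic X Y f g"
  shows "simplicially_homotopic (SD X) (SD Y) (SD_map X f) (SD_map X g)"
proof -
  obtain F where F: "F \<in> smooth_maps (prod_diffeology X real_diffeology) Y"
    and F01: "\<And>x. x \<in> points X \<Longrightarrow> F (x, 0) = f x \<and> F (x, 1) = g x"
    using assms(5) by (auto simp: smoothly_homotopic_def)
  have "SD_prism X F n (\<sigma>, \<lambda>i\<in>{..n}. 0) = SD_map X f n \<sigma>"
    "SD_prism X F n (\<sigma>, \<lambda>i\<in>{..n}. 1) = SD_map X g n \<sigma>"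
    if \<sigma>: "\<sigma> \<in> simplices (SD X) n" for n \<sigma>
  proof -
    have "\<sigma> x \<in> points X" if "x \<in> points (affine_simplex n)" for x
      using \<sigma> that by (auto simp: simplices_SD smooth_maps_def)
    then show "SD_prism X F n (\<sigma>, \<lambda>i\<in>{..n}. 0) = SD_map X f n \<sigma>"
      "SD_prism X F n (\<sigma>, \<lambda>i\<in>{..n}. 1) = SD_map X g n \<sigma>"
      using \<sigma> F01 const_simplex_mor[of 0 1 n] const_simplex_mor[of 1 1 n]
        affine_push_const_0[of n] affine_push_const_1[of _ n]
      by (auto simp: SD_prism_def SD_map_def compose_def fun_eq_iff simp del: One_nat_def)
  qed
  then have "\<exists>H. simplicial_map (sset_prod (SD X) (standard_simplex 1)) (SD Y) H \<and>
      (\<forall>n. \<forall>\<sigma>\<in>simplices (SD X) n. H n (\<sigma>, \<lambda>i\<in>{..n}. 0) = SD_map X f n \<sigma> \<and>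
                                  H n (\<sigma>, \<lambda>i\<in>{..n}. 1) = SD_map X g n \<sigma>)"
    using simplicial_map_SD_prism[OF F] by (intro exI[of _ "SD_prism X F"]) simp
  then show ?thesis
    unfolding simplicially_homotopic_def
    using simplicial_set_SD[of X] simplicial_set_SD[of Y] simplicial_map_SD[OF assms(3)]
      simplicial_map_SD[OF assms(4)]
    by (intro conjI)
qed

end
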